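(* For all $n\ge1$, $$\sum_{\sigma\in\mathcal Y^*_{2n+1}}a^{\mathrm{lema}\,\sigma}p^{(2\text{-}13)\sigma}q^{(31\text{-}2)\sigma}y^{\mathrm{dd}\,\sigma}t^{\mathrm{des}\,\sigma}=\sum_{k=0}^{\lfloor n/2\rfloor}\gamma_{n,k}(a,p,q)\,t^k(1+yt)^{n-2k},$$ with coefficients $$\gamma_{n,k}(a,p,q)=\sum_{\sigma\in\overline{\mathcal Y}^*_{2n+1,k}}a^{\mathrm{lema}\,\sigma}p^{(2\text{-}13)\sigma}q^{(31\text{-}2)\sigma}.$$
   Context: Permutations $\sigma\in\mathfrak S_m$ of $[m]=\{1,\dots,m\}$ are written as words $\sigma_1\cdots\sigma_m$. A descent of $\sigma$ is a pair $(\sigma_i,\sigma_{i+1})$, $1\le i\le m-1$, with $\sigma_i>\sigma_{i+1}$ (top $\sigma_i$, bottom $\sigma_{i+1}$); $\mathrm{des}\,\sigma$ is the number of descents. $\mathcal Y^*_{2n+1}$ is the set of $\sigma\in\mathfrak S_{2n+1}$ such that every descent has odd top and odd bottom, and such that the last letter $\sigma_{2n+1}$ is odd. With the convention $\sigma_0=\sigma_{m+1}=0$ for $\sigma\in\mathfrak S_m$, the value $\sigma_i$ ($1\le i\le m$) is a peak if $\sigma_{i-1}<\sigma_i>\sigma_{i+1}$ and a double descent if $\sigma_{i-1}>\sigma_i>\sigma_{i+1}$; $\mathrm{dd}\,\sigma$ is the number of double descents. An $\mathcal F$-permutation is a $\sigma\in\mathcal Y^*_{2n+1}$ with no double descent and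 whose last entry is a peak, i.e. $\sigma_{2n}<\sigma_{2n+1}$. $\overline{\mathcal Y}^*_{2n+1}$ is the set of $\mathcal F$-permutations in $\mathfrak S_{2n+1}$ and $\overline{\mathcal Y}^*_{2n+1,k}$ the subset of those with $k$ descents. $\mathrm{lema}\,\sigma$ is the number of even values $\sigma_i$ with $\sigma_j<\sigma_i$ for all $j<i$. For $\sigma\in\mathfrak S_m$: $(31\text{-}2)\sigma$ is the number of pairs $(i,j)$ with $2\le i<j\le m$ and $\sigma_{i-1}>\sigma_j>\sigma_i$; $(2\text{-}13)\sigma$ is the number of pairs $(i,j)$ with $1\le i<j\le m-1$ and $\sigma_{j+1}>\sigma_i>\sigma_j$. *)

theory Defs
  imports "HOL-Combinatorics.Multiset_Permutations"
begin

text \<open>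
  A permutation of \<open>{1..m}\<close> is the list of its letters, an element of
  \<open>permutations_of_set {1..m}\<close>.  Positions are numbered from 1, and positions outside
  \<open>{1..m}\<close> carry the letter 0, which is the boundary convention used for peaks and
  double descents.
\<close>

definition letter :: "nat list \<Rightarrow> nat \<Rightarrow> nat" where
  "letter w i = (if 1 \<le> i \<and> i \<le> length w then w ! (i - 1) else 0)"

text \<open>Descents are pairs (top, bottom) inside the word; the boundary zeros do not take part.\<close>

definition descents :: "nat list \<Rightarrow> (nat \<times> nat) set" where
  "descents w = {(letter w i, letter w (i + 1)) | i.
     1 \<le> i \<and> i < length w \<and> letter w i > letter w (i + 1)}"

definition des :: "nat list \<Rightarrow> nat" where
  "des w = card (descents w)"

definition peaks :: "nat list \<Rightarrow> nat set" where
  "peaks w = {letter w i | i. 1 \<le> i \<and> i \<le> length w \<and>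
     letter w (i - 1) < letter w i \<and> letter w i > letter w (i + 1)}"

definition double_descents :: "nat list \<Rightarrow> nat set" where
  "double_descents w = {letter w i | i. 1 \<le> i \<and> i \<le> length w \<and>
     letter w (i - 1) > letter w i \<and> letter w i > letter w (i + 1)}"

definition dd :: "nat list \<Rightarrow> nat" where
  "dd w = card (double_descents w)"

definition lema :: "nat list \<Rightarrow> nat" where
  "lema w = card {letter w i | i. 1 \<le> i \<and> i \<le> length w \<and> even (letter w i) \<and>
     (\<forall>j. 1 \<le> j \<and> j < i \<longrightarrow> letter w j < letter w i)}"

definition pat_31_2 :: "nat list \<Rightarrow> nat" where
  "pat_31_2 w = card {(i, j). 2 \<le> i \<and> i < j \<and> j \<le> length w \<and>
     letter w (i - 1) > letter w j \<and> letter w j > letter w i}"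

definition pat_2_13 :: "nat list \<Rightarrow> nat" where
  "pat_2_13 w = card {(i, j). 1 \<le> i \<and> i < j \<and> j < length w \<and>
     letter w (j + 1) > letter w i \<and> letter w i > letter w j}"

definition Ystar :: "nat \<Rightarrow> nat list set" where
  "Ystar n = {w \<in> permutations_of_set {1..2 * n + 1}.
     (\<forall>(x, y) \<in> descents w. odd x \<and> odd y) \<and> odd (letter w (2 * n + 1))}"

definition F_permutations :: "nat \<Rightarrow> nat list set" where
  "F_permutations n = {w \<in> Ystar n.
     double_descents w = {} \<and> letter w (2 * n + 1) \<in> peaks w}"

definition F_permutations_des :: "nat \<Rightarrow> nat \<Rightarrow> nat list set" where
  "F_permutations_des n k = {w \<in> F_permutations n. des w = k}"

definition gamma_coeff :: "nat \<Rightarrow> nat \<Rightarrow> 'a \<Rightarrow> 'a \<Rightarrow> 'a \<Rightarrow> 'a::comm_ring_1" where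
  "gamma_coeff n k a p q =
     (\<Sum>w\<in>F_permutations_des n k. a ^ lema w * p ^ pat_2_13 w * q ^ pat_31_2 w)"

lemma finite_Ystar: "finite (Ystar n)"
  by (simp add: Ystar_def)

lemma finite_F_permutations_des: "finite (F_permutations_des n k)"
  by (simp add: F_permutations_des_def F_permutations_def finite_Ystar)

end

theory Submission
  imports Defs
begin

text \<open>
  The identity comes from valley hopping.  Call a letter a double ascent, double descent, peak or
  valley according to how it compares with its two neighbours, the word being bordered by zeros.
  If \<open>x\<close> is a double ascent of \<open>w = s x m r\<close>, where \<open>m\<close> is the maximal block of letters larger
  than \<open>x\<close> directly to the right of \<open>x\<close>, then in \<open>w' = s m x r\<close> the letter \<open>x\<close> is a double
  descent, and \<open>w\<close> can be recovered from \<open>w'\<close> by the mirror image of this move (relation \<open>hop\<close>).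

  The hop is invisible to everything else.  The letters that precede and follow the block formed by
  \<open>x\<close> and \<open>m\<close> are smaller than \<open>x\<close>, hence smaller than every letter of the block.  So the outer
  letters keep a larger neighbour in the block, the first and the last letter of \<open>m\<close> keep a smaller
  neighbour outside of \<open>m\<close>, and no letter but \<open>x\<close> changes its type.  Moreover both vincular statistics can be computed letter by letter: the letter
  \<open>c\<close>, in the role of the 2, contributes to 31-2 the number of descents across level \<open>c\<close> to its
  left, and to 2-13 the number of ascents across level \<open>c\<close> to its right.  A hop removes \<open>x\<close> from
  the climb into the block and inserts it in the drop out of it; neither changes how often a level
  is crossed in a given direction (lemma \<open>hop_letterwise\<close>).  If \<open>x\<close> is odd, then \<open>lema\<close> is preserved too.

  A permutation of \<open>{1..2n+1}\<close> belongs to \<open>Ystar n\<close> exactly when all its even letters are double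
  ascents (lemma \<open>Ystar_iff\<close>); hence the hops of odd letters preserve \<open>Ystar n\<close>.  Treating the odd
  letters one at a time, one can remove the words in which \<open>x\<close> is a double descent from the sum, if
  a factor \<open>1 + y t\<close> is given to each word in which \<open>x\<close> is a double ascent (lemma
  \<open>sum_Ystar_without_double_descents_in\<close>).  When all odd letters have been treated, exactly the
  F-permutations remain, with one factor \<open>1 + y t\<close> per odd double ascent.  There are \<open>n - 2 k\<close> of
  them when \<open>k\<close> is the number of descents: the \<open>n + 1\<close> odd letters consist of the odd double
  ascents, \<open>k\<close> valleys and \<open>k + 1\<close> peaks.
\<close>

section \<open>Statistics read off from the surroundings of a letter\<close>

text \<open>
  The prefix and the suffix that surround \<open>c\<close> are taken as functions of the value \<open>c\<close> and not of
  its position, because a hop changes positions but not the set of letters: sums over letters can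
  then be compared term by term.
\<close>

definition before :: "nat \<Rightarrow> nat list \<Rightarrow> nat list" where
  "before c w = takeWhile (\<lambda>b. b \<noteq> c) w"

definition after :: "nat \<Rightarrow> nat list \<Rightarrow> nat list" where
  "after c w = tl (dropWhile (\<lambda>b. b \<noteq> c) w)"

text \<open>
  Comparison of \<open>c\<close> with its left and its right neighbour; a missing neighbour counts as 0, in
  accordance with the boundary convention.
\<close>

definition rise :: "nat list \<Rightarrow> nat \<Rightarrow> bool" where
  "rise w c \<longleftrightarrow> last (0 # before c w) < c"

definition fall :: "nat list \<Rightarrow> nat \<Rightarrow> bool" where
  "fall w c \<longleftrightarrow> hd (after c w @ [0]) < c"

text \<open>
  The first letter of \<open>w\<close> is compared with the extra letter \<open>p\<close>; with this parameter the count is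
  additive over concatenation.
\<close>

fun steps :: "(nat \<Rightarrow> nat \<Rightarrow> bool) \<Rightarrow> nat \<Rightarrow> nat list \<Rightarrow> nat" where
  "steps R p [] = 0"
| "steps R p (b # w) = (if R p b then 1 else 0) + steps R b w"

text \<open>
  Steps across level \<open>c\<close>.  A descent never starts from \<open>p = 0\<close>, and an ascent across level \<open>c\<close>
  never starts from \<open>p = c\<close>; with these initial letters only genuine steps of the word count.
\<close>

abbreviation desc_over :: "nat \<Rightarrow> nat \<Rightarrow> nat list \<Rightarrow> nat" where
  "desc_over c \<equiv> steps (\<lambda>a b. a > c \<and> c > b)"

abbreviation asc_over :: "nat \<Rightarrow> nat \<Rightarrow> nat list \<Rightarrow> nat" where
  "asc_over c \<equiv> steps (\<lambda>a b. b > c \<and> c > a)"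

lemma steps_append: "steps R p (u @ v) = steps R p u + steps R (last (p # u)) v"
  by (induction u arbitrary: p) auto

lemma steps_eq_card:
  "steps R p w = card {i. i < length w \<and> R ((p # w) ! i) (w ! i)}"
proof (induction w arbitrary: p)
  case Nil
  then show ?case by simp
next
  case (Cons b w)
  let ?A = "{i. i < length w \<and> R ((b # w) ! i) (w ! i)}"
  have "{i. i < length (b # w) \<and> R ((p # b # w) ! i) ((b # w) ! i)} =
      (if R p b then {0} else {}) \<union> Suc ` ?A"
    by (auto simp: less_Suc_eq_0_disj image_iff)
  also have "card \<dots> = (if R p b then 1 else 0) + card ?A"
    by (auto simp: card_image card_insert_if)
  finally show ?case using Cons.IH by simp
qed

lemma desc_over_eq_0: "\<forall>b\<in>set w. c \<le> b \<Longrightarrow> desc_over c p w = 0"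
  by (induction w arbitrary: p) auto

lemma asc_over_eq_0: "\<forall>b\<in>set (p # w). c \<le> b \<Longrightarrow> asc_over c p w = 0"
  by (induction w arbitrary: p) auto

lemma before_append: "c \<notin> set u \<Longrightarrow> before c (u @ c # v) = u"
  by (simp add: before_def takeWhile_append)

lemma after_append: "c \<notin> set u \<Longrightarrow> after c (u @ c # v) = v"
  by (simp add: after_def dropWhile_append)

lemma before_after_letter:
  assumes "distinct w" "1 \<le> i" "i \<le> length w"
  shows "before (letter w i) w = take (i - 1) w" "after (letter w i) w = drop i w"
proof -
  have w: "w = take (i - 1) w @ letter w i # drop i w"
    using assms id_take_nth_drop[of "i - 1" w] by (simp add: letter_def)
  then have "letter w i \<notin> set (take (i - 1) w)"
    using assms(1) by (metis distinct_append disjoint_iff list.set_intros(1))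
  with w show "before (letter w i) w = take (i - 1) w" "after (letter w i) w = drop i w"
    by (metis before_append, metis after_append)
qed

lemma rise_letter:
  assumes "distinct w" "1 \<le> i" "i \<le> length w"
  shows "rise w (letter w i) \<longleftrightarrow> letter w (i - 1) < letter w i"
proof -
  have "last (0 # take (i - 1) w) = letter w (i - 1)"
    using assms by (cases "i = 1") (auto simp: letter_def last_conv_nth min_def)
  then show ?thesis
    using before_after_letter[OF assms] by (simp only: rise_def)
qed

lemma fall_letter:
  assumes "distinct w" "1 \<le> i" "i \<le> length w"
  shows "fall w (letter w i) \<longleftrightarrow> letter w (i + 1) < letter w i"
proof -
  have "hd (drop i w @ [0]) = letter w (i + 1)"
    using assms by (cases "i = length w") (auto simp: letter_def hd_drop_conv_nth hd_append)
  then show ?thesis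
    using before_after_letter[OF assms] by (simp only: fall_def)
qed

lemma set_eq_letters: "set w = letter w ` {1..length w}"
proof -
  have "set w = (\<lambda>i. letter w (Suc i)) ` {0..<length w}"
    by (auto simp: letter_def set_conv_nth image_iff)
  also have "\<dots> = letter w ` {1..length w}"
    by (simp only: image_image[symmetric] image_Suc_atLeastLessThan) (simp add: atLeastLessThanSuc_atLeastAtMost)
  finally show ?thesis .
qed

lemma inj_on_letter: "distinct w \<Longrightarrow> inj_on (letter w) {1..length w}"
  by (auto simp: inj_on_def letter_def nth_eq_iff_index_eq)

lemma letter_in_set: "1 \<le> i \<Longrightarrow> i \<le> length w \<Longrightarrow> letter w i \<in> set w"
  by (auto simp: letter_def)

lemma letter_neq_neighbour:
  assumes "distinct w" "0 \<notin> set w" "1 \<le> i" "i \<le> length w"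
  shows "letter w (i - 1) \<noteq> letter w i" "letter w (i + 1) \<noteq> letter w i"
proof -
  have "w ! (i - 1) \<noteq> 0" using assms by (metis One_nat_def Suc_le_lessD Suc_pred nth_mem less_eq_Suc_le)
  then show "letter w (i - 1) \<noteq> letter w i" "letter w (i + 1) \<noteq> letter w i"
    using assms by (auto simp: letter_def nth_eq_iff_index_eq)
qed

lemma Collect_letter:
  assumes "\<And>i. 1 \<le> i \<Longrightarrow> i \<le> length w \<Longrightarrow> P i \<longleftrightarrow> Q (letter w i)"
  shows "{letter w i | i. 1 \<le> i \<and> i \<le> length w \<and> P i} = {c \<in> set w. Q c}"
  using assms by (auto simp: set_eq_letters)

lemma double_descents_eq:
  assumes "distinct w" "0 \<notin> set w"
  shows "double_descents w = {c \<in> set w. \<not> rise w c \<and> fall w c}"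
  unfolding double_descents_def
proof (rule Collect_letter)
  fix i assume "1 \<le> i" "i \<le> length w"
  then show "letter w (i - 1) > letter w i \<and> letter w i > letter w (i + 1) \<longleftrightarrow>
      \<not> rise w (letter w i) \<and> fall w (letter w i)"
    using assms letter_neq_neighbour[OF assms, of i] rise_letter[of w i] fall_letter[of w i]
    by linarith
qed

lemma peaks_eq:
  assumes "distinct w"
  shows "peaks w = {c \<in> set w. rise w c \<and> fall w c}"
  unfolding peaks_def
  by (rule Collect_letter) (use assms in \<open>auto simp: rise_letter fall_letter\<close>)

lemma lema_eq:
  assumes "distinct w"
  shows "lema w = card {c \<in> set w. even c \<and> (\<forall>b\<in>set (before c w). b < c)}"
proof -
  have "(\<forall>j. 1 \<le> j \<and> j < i \<longrightarrow> letter w j < letter w i) \<longleftrightarrow>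
      (\<forall>b\<in>set (before (letter w i) w). b < letter w i)" if "1 \<le> i" "i \<le> length w" for i
  proof -
    have "set (take (i - 1) w) = letter w ` {1..i - 1}"
      using that unfolding set_eq_letters[of "take (i - 1) w"]
      by (intro image_cong) (auto simp: letter_def)
    then show ?thesis
      using that assms by (force simp: before_after_letter)
  qed
  then show ?thesis
    unfolding lema_def by (subst Collect_letter) auto
qed

text \<open>
  In both vincular patterns the pairs are grouped by the position of the letter that plays the role
  of the 2.
\<close>

lemma card_pairs_by_snd:
  assumes "finite J" "\<And>i j. P i j \<Longrightarrow> j \<in> J" "\<And>j. finite {i. P i j}"
  shows "card {(i, j). P i j} = (\<Sum>j\<in>J. card {i. P i j})"
proof -
  have "{(i, j). P i j} = prod.swap ` (SIGMA j:J. {i. P i j})"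
    using assms(2) by (auto simp: image_iff)
  then show ?thesis
    using assms by (simp add: card_image)
qed

lemma pat_31_2_eq:
  assumes "distinct w"
  shows "pat_31_2 w = (\<Sum>c\<in>set w. desc_over c 0 (before c w))"
proof -
  let ?P = "\<lambda>i j. 2 \<le> i \<and> i < j \<and> j \<le> length w \<and>
     letter w (i - 1) > letter w j \<and> letter w j > letter w i"
  have "pat_31_2 w = (\<Sum>j\<in>{1..length w}. card {i. ?P i j})"
    unfolding pat_31_2_def
    by (rule card_pairs_by_snd) (auto intro: finite_subset[of _ "{..length w}"])
  also have "\<dots> = (\<Sum>j\<in>{1..length w}. desc_over (letter w j) 0 (before (letter w j) w))"
  proof (rule sum.cong)
    fix j assume j: "j \<in> {1..length w}"
    let ?u = "take (j - 1) w"
    have "{i. ?P i j} = Suc ` {i. i < length ?u \<and> (0 # ?u) ! i > letter w j \<and> letter w j > ?u ! i}"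
      (is "?L = Suc ` ?R")
    proof (intro set_eqI iffI)
      fix i assume "i \<in> ?L"
      then show "i \<in> Suc ` ?R"
        using j by (intro image_eqI[of _ _ "i - 1"]) (auto simp: letter_def nth_Cons' split: if_splits)
    next
      fix i assume "i \<in> Suc ` ?R"
      then obtain k where k: "i = Suc k" "k \<in> ?R" by blast
      then have "k \<noteq> 0" by (intro notI) simp
      then show "i \<in> ?L"
        using k j by (auto simp: letter_def nth_Cons')
    qed
    then have "card {i. ?P i j} = desc_over (letter w j) 0 ?u"
      by (simp add: card_image steps_eq_card)
    then show "card {i. ?P i j} = desc_over (letter w j) 0 (before (letter w j) w)"
      using j assms by (simp add: before_after_letter)
  qed simp
  also have "\<dots> = (\<Sum>c\<in>set w. desc_over c 0 (before c w))"
    by (simp only: set_eq_letters sum.reindex[OF inj_on_letter[OF assms]] comp_def)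
  finally show ?thesis .
qed

lemma pat_2_13_eq:
  assumes "distinct w"
  shows "pat_2_13 w = (\<Sum>c\<in>set w. asc_over c c (after c w))"
proof -
  let ?P = "\<lambda>i j. 1 \<le> i \<and> i < j \<and> j < length w \<and>
     letter w (j + 1) > letter w i \<and> letter w i > letter w j"
  \<comment> \<open>Here the 2 comes first, so the pair is swapped to bring its position into second place.\<close>
  have "pat_2_13 w = card {(j, i). ?P i j}"
    unfolding pat_2_13_def
    by (rule bij_betw_same_card[of prod.swap]) (auto simp: bij_betw_def inj_on_def image_iff)
  also have "\<dots> = (\<Sum>i\<in>{1..length w}. card {j. ?P i j})"
    by (rule card_pairs_by_snd) (auto intro: finite_subset[of _ "{..length w}"])
  also have "\<dots> = (\<Sum>i\<in>{1..length w}. asc_over (letter w i) (letter w i) (after (letter w i) w))"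
  proof (rule sum.cong)
    fix i assume i: "i \<in> {1..length w}"
    let ?u = "drop i w" and ?c = "letter w i"
    have "{j. ?P i j} = (\<lambda>k. k + i) ` {k. k < length ?u \<and> ?u ! k > ?c \<and> ?c > (?c # ?u) ! k}"
      (is "?L = ?f ` ?R")
    proof (intro set_eqI iffI)
      fix j assume "j \<in> ?L"
      then show "j \<in> ?f ` ?R"
        using i by (intro image_eqI[of _ _ "j - i"]) (auto simp: letter_def nth_Cons')
    next
      fix j assume "j \<in> ?f ` ?R"
      then obtain k where k: "j = k + i" "k \<in> ?R" by blast
      then have "k \<noteq> 0" by (intro notI) simp
      then show "j \<in> ?L"
        using k i by (auto simp: letter_def nth_Cons' add.commute)
    qed
    then have "card {j. ?P i j} = asc_over ?c ?c ?u"
      by (simp add: card_image steps_eq_card)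
    then show "card {j. ?P i j} = asc_over ?c ?c (after ?c w)"
      using i assms by (simp add: before_after_letter)
  qed simp
  also have "\<dots> = (\<Sum>c\<in>set w. asc_over c c (after c w))"
    by (simp only: set_eq_letters sum.reindex[OF inj_on_letter[OF assms]] comp_def)
  finally show ?thesis .
qed

section \<open>Valley hopping\<close>

text \<open>
  The double ascent \<open>x\<close> jumps over the block \<open>m\<close>.  The condition on \<open>r\<close> makes \<open>m\<close> the maximal
  block of larger letters to the right of \<open>x\<close> in the first word; the condition on \<open>s\<close> makes it
  the maximal one to the left of \<open>x\<close> in the second.  This symmetry under reversal is what makes
  a relation more convenient than a function: existence and uniqueness of the inverse move follow
  from \<open>hop_rev\<close>.
\<close>

definition hop :: "nat \<Rightarrow> nat list \<Rightarrow> nat list \<Rightarrow> bool" where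
  "hop x w w' \<longleftrightarrow> (\<exists>s m r. w = s @ x # m @ r \<and> w' = s @ m @ x # r \<and> distinct w \<and>
     m \<noteq> [] \<and> (\<forall>b\<in>set m. x < b) \<and> last (0 # s) < x \<and> hd (r @ [0]) < x)"

text \<open>
  The step from \<open>p\<close> up to the first letter of \<open>m\<close> passes level \<open>x\<close>, and the step from the last
  letter of \<open>m\<close> down to \<open>r\<close> does so too.  Inserting \<open>x\<close> splits such a step into two of the same
  direction, exactly one of which crosses a given level \<open>c \<noteq> x\<close> crossed before.
\<close>

lemma asc_over_hop:
  assumes "p < x" "m \<noteq> []" "\<forall>b\<in>set m. x < b" "hd (r @ [0]) < x" "c \<noteq> x"
  shows "asc_over c p (x # m @ r) = asc_over c p (m @ x # r)"
proof -
  obtain h m' where m: "m = h # m'" using assms(2) by (cases m) auto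
  have "x < last m" "x < h" using assms(2,3) m by auto
  then show ?thesis
    using assms(1,4,5) by (cases r) (auto simp: m steps_append)
qed

text \<open>
  The boundary case of an empty \<open>r\<close> differs from that of \<open>asc_over_hop\<close>: this statement is used
  for the part of the word that precedes \<open>c\<close>, so the letter after \<open>r\<close> is \<open>c\<close> itself.
\<close>

lemma desc_over_hop:
  assumes "p < x" "m \<noteq> []" "\<forall>b\<in>set m. x < b" "hd (r @ [c]) < x" "c \<noteq> x"
  shows "desc_over c p (x # m @ r) = desc_over c p (m @ x # r)"
proof -
  obtain h m' where m: "m = h # m'" using assms(2) by (cases m) auto
  have "x < last m" "x < h" using assms(2,3) m by auto
  then show ?thesis
    using assms(1,4,5) by (cases r) (auto simp: m steps_append)
qed

text \<open>
  The cases are the four possible places of \<open>c\<close>.  For \<open>c\<close> in \<open>s\<close> or \<open>r\<close> the whole move takes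
  place on one side of \<open>c\<close>.  For \<open>c\<close> in \<open>m\<close> the letter \<open>x\<close> changes sides, but as \<open>x < c\<close> and its
  other neighbour is smaller still, it creates no crossing of level \<open>c\<close>.  For \<open>c = x\<close> it is \<open>m\<close>
  that changes sides, and it lies entirely above level \<open>x\<close>.
\<close>

lemma hop_letterwise:
  assumes "hop x w w'" "c \<in> set w"
  shows "desc_over c 0 (before c w) = desc_over c 0 (before c w')"
    and "asc_over c c (after c w) = asc_over c c (after c w')"
    and "c \<noteq> x \<Longrightarrow> rise w c = rise w' c"
    and "c \<noteq> x \<Longrightarrow> fall w c = fall w' c"
    and "c \<noteq> x \<Longrightarrow> (\<forall>b\<in>set (before c w). b < c) = (\<forall>b\<in>set (before c w'). b < c)"
proof -
  obtain s m r where w: "w = s @ x # m @ r" and w': "w' = s @ m @ x # r" and d: "distinct w"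
    and m: "m \<noteq> []" "\<forall>b\<in>set m. x < b" and s: "last (0 # s) < x" and r: "hd (r @ [0]) < x"
    using assms(1) unfolding hop_def by blast
  have l: "x < last m" and h: "x < hd m" using m by auto
  obtain h' m' where m': "m = h' # m'" using m by (cases m) auto
  let ?G = "desc_over c 0 (before c w) = desc_over c 0 (before c w') \<and>
    asc_over c c (after c w) = asc_over c c (after c w') \<and>
    (c \<noteq> x \<longrightarrow> rise w c = rise w' c \<and> fall w c = fall w' c \<and>
      (\<forall>b\<in>set (before c w). b < c) = (\<forall>b\<in>set (before c w'). b < c))"
  consider "c \<in> set s" | "c = x" | "c \<in> set m" | "c \<in> set r"
    using assms(2) w by auto
  then have ?G
  proof cases
    case 1
    then obtain s1 s2 where s12: "s = s1 @ c # s2" by (meson split_list)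
    have c: "c \<notin> set s1" using d w s12 by auto
    have ba: "before c w = s1" "before c w' = s1"
      "after c w = s2 @ x # m @ r" "after c w' = s2 @ m @ x # r"
      using c before_append[OF c] after_append[OF c] by (simp_all add: w w' s12)
    have p: "last (c # s2) < x" using s s12 by (simp split: if_splits)
    have "c \<noteq> x" using d w s12 by auto
    then have "asc_over c c (s2 @ x # m @ r) = asc_over c c (s2 @ m @ x # r)"
      using asc_over_hop[OF p m r] by (simp add: steps_append[of _ c s2])
    moreover have "fall w c = fall w' c"
      using ba p h by (cases s2) (auto simp: fall_def m' hd_append)
    ultimately show ?thesis using ba by (simp add: rise_def)
  next
    case 2
    have c: "x \<notin> set s" "x \<notin> set (s @ m)" using d w by auto
    have ba: "before x w = s" "before x w' = s @ m" "after x w = m @ r" "after x w' = r"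
      using before_append[OF c(1)] after_append[OF c(1)] before_append[OF c(2)] after_append[OF c(2)]
      by (simp_all add: w w')
    have "desc_over x (last (0 # s)) m = 0" "asc_over x x m = 0"
      using m by (auto intro!: desc_over_eq_0 asc_over_eq_0 simp: less_imp_le)
    moreover have "asc_over x (last (x # m)) r = asc_over x x r"
      using r by (cases r) auto
    ultimately show ?thesis
      by (simp add: 2 ba steps_append)
  next
    case 3
    then obtain m1 m2 where m12: "m = m1 @ c # m2" by (meson split_list)
    have c: "c \<notin> set (s @ x # m1)" "c \<notin> set (s @ m1)" using d w m12 by auto
    have ba: "before c w = s @ x # m1" "before c w' = s @ m1"
      "after c w = m2 @ r" "after c w' = m2 @ x # r"
      using before_append[OF c(1)] after_append[OF c(1)] before_append[OF c(2)] after_append[OF c(2)]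
      by (simp_all add: w w' m12)
    have xc: "x < c" using m m12 by auto
    have l': "x < last (c # m2)" using m m12 by auto
    have "desc_over c (last (0 # s)) (x # m1) = desc_over c (last (0 # s)) m1"
      using xc s by (cases m1) auto
    moreover have "asc_over c (last (c # m2)) (x # r) = asc_over c (last (c # m2)) r"
      using xc r by (cases r) auto
    moreover have "rise w c = rise w' c"
      using ba xc s by (cases m1) (auto simp: rise_def)
    moreover have "fall w c = fall w' c"
      using ba xc r by (cases m2) (auto simp: fall_def)
    moreover have "(\<forall>b\<in>set (before c w). b < c) = (\<forall>b\<in>set (before c w'). b < c)"
      using ba xc by auto
    ultimately show ?thesis
      by (simp add: ba steps_append)
  next
    case 4
    then obtain r1 r2 where r12: "r = r1 @ c # r2" by (meson split_list)
    have c: "c \<notin> set (s @ x # m @ r1)" "c \<notin> set (s @ m @ x # r1)" using d w r12 by auto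
    have ba: "before c w = s @ x # m @ r1" "before c w' = s @ m @ x # r1"
      "after c w = r2" "after c w' = r2"
      using before_append[OF c(1)] after_append[OF c(1)] before_append[OF c(2)] after_append[OF c(2)]
      by (simp_all add: w w' r12)
    have cx: "c \<noteq> x" using d w r12 by auto
    have r1: "hd (r1 @ [c]) < x" using r r12 by (cases r1) auto
    have "\<not> last m < c" if "r1 = []" using that l r1 by simp
    then have "rise w c = rise w' c"
      using ba l r1 m by (cases r1) (auto simp: rise_def)
    then show ?thesis
      using ba desc_over_hop[OF s m r1 cx]
      by (simp add: fall_def steps_append[of _ 0 s])
  qed
  then show "desc_over c 0 (before c w) = desc_over c 0 (before c w')"
    and "asc_over c c (after c w) = asc_over c c (after c w')"
    and "c \<noteq> x \<Longrightarrow> rise w c = rise w' c"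
    and "c \<noteq> x \<Longrightarrow> fall w c = fall w' c"
    and "c \<noteq> x \<Longrightarrow> (\<forall>b\<in>set (before c w). b < c) = (\<forall>b\<in>set (before c w'). b < c)"
    by blast+
qed

lemma hop_set_distinct:
  assumes "hop x w w'"
  shows "set w' = set w" "distinct w" "distinct w'" "x \<in> set w"
  using assms by (auto simp: hop_def)

lemma hop_rev: "hop x w w' \<Longrightarrow> hop x (rev w') (rev w)"
proof -
  assume "hop x w w'"
  then obtain s m r where *: "w = s @ x # m @ r" "w' = s @ m @ x # r" "distinct w"
    "m \<noteq> []" "\<forall>b\<in>set m. x < b" "last (0 # s) < x" "hd (r @ [0]) < x"
    unfolding hop_def by blast
  have "last (0 # rev r) = hd (r @ [0])" "hd (rev s @ [0]) = last (0 # s)"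
    by (cases r; simp) (cases s rule: rev_cases; simp)
  then show ?thesis
    unfolding hop_def using *
    by (intro exI[of _ "rev r"] exI[of _ "rev m"] exI[of _ "rev s"]) auto
qed

text \<open>The landing place is determined, since \<open>m\<close> can only be the maximal block of larger letters.\<close>

lemma hop_functional:
  assumes "hop x w w1" "hop x w w2"
  shows "w1 = w2"
proof -
  have "w' = before x w @ takeWhile (\<lambda>b. x < b) (after x w) @ x # dropWhile (\<lambda>b. x < b) (after x w)"
    if hop: "hop x w w'" for w'
  proof -
    obtain s m r where *: "w = s @ x # m @ r" "w' = s @ m @ x # r" "distinct w"
      "\<forall>b\<in>set m. x < b" "hd (r @ [0]) < x"
      using hop unfolding hop_def by blast
    have "x \<notin> set s" using * by auto
    then have ba: "before x w = s" "after x w = m @ r"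
      using * before_append after_append by simp_all
    have "takeWhile (\<lambda>b. x < b) (m @ r) = m" "dropWhile (\<lambda>b. x < b) (m @ r) = r"
      using * by (cases r; simp add: takeWhile_append dropWhile_append)+
    then show ?thesis using * ba by simp
  qed
  then show ?thesis using assms by metis
qed

lemma hop_injective: "hop x w1 w \<Longrightarrow> hop x w2 w \<Longrightarrow> w1 = w2"
  using hop_functional[OF hop_rev hop_rev] by (metis rev_rev_ident)

lemma hop_at:
  assumes "hop x w w'"
  shows "rise w x" "\<not> fall w x" "\<not> rise w' x" "fall w' x"
proof -
  obtain s m r where *: "w = s @ x # m @ r" "w' = s @ m @ x # r" "distinct w"
    "m \<noteq> []" "\<forall>b\<in>set m. x < b" "last (0 # s) < x" "hd (r @ [0]) < x"
    using assms unfolding hop_def by blast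
  have "x \<notin> set s" "x \<notin> set (s @ m)" using * by auto
  then have ba: "before x w = s" "after x w = m @ r" "before x w' = s @ m" "after x w' = r"
    using * before_append[of x s "m @ r"] after_append[of x s "m @ r"]
      before_append[of x "s @ m" r] after_append[of x "s @ m" r] by simp_all
  have "x < last m" "x < hd m" using * by auto
  then have "\<not> last m < x" "\<not> hd m < x" by simp_all
  then show "rise w x" "\<not> fall w x" "\<not> rise w' x" "fall w' x"
    using *(4-7) by (auto simp: rise_def fall_def ba hd_append)
qed

text \<open>
  A double ascent has a larger right neighbour, so the block over which it hops is not empty.
\<close>

lemma hop_exists:
  assumes "distinct w" "x \<in> set w" "rise w x" "\<not> fall w x" "0 < x"
  shows "\<exists>w'. hop x w w'"
proof -
  obtain s v where w: "w = s @ x # v" using assms(2) by (meson split_list)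
  have s: "x \<notin> set s" "x \<notin> set v" using w assms(1) by auto
  have s': "last (0 # s) < x" using assms(3) by (simp add: rise_def w before_append s)
  have v: "\<not> hd (v @ [0]) < x" using assms(4) by (simp add: fall_def w after_append s)
  let ?m = "takeWhile (\<lambda>b. x < b) v" and ?r = "dropWhile (\<lambda>b. x < b) v"
  have "?m \<noteq> []" using v s(2) assms(5) by (cases v) auto
  moreover have "hd (?r @ [0]) < x"
  proof (cases "?r = []")
    case False
    then have "\<not> x < hd ?r" by (rule hd_dropWhile)
    moreover have "hd ?r \<noteq> x" using False s(2) by (metis hd_in_set set_dropWhileD)
    ultimately show ?thesis using False by (simp add: hd_append)
  qed (use assms(5) in \<open>simp only: append_Nil list.sel\<close>)
  ultimately have "hop x w (s @ ?m @ x # ?r)"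
    unfolding hop_def using s' assms(1) w
    by (intro exI[of _ s] exI[of _ ?m] exI[of _ ?r]) (auto dest: set_takeWhileD)
  then show ?thesis ..
qed

lemma rise_fall_rev:
  assumes "distinct w" "x \<in> set w"
  shows "rise (rev w) x = fall w x" "fall (rev w) x = rise w x"
proof -
  obtain s v where w: "w = s @ x # v" using assms(2) by (meson split_list)
  have s: "x \<notin> set s" "x \<notin> set v" using w assms(1) by auto
  have "last (0 # rev v) = hd (v @ [0])" "hd (rev s @ [0]) = last (0 # s)"
    by (cases v; simp) (cases s rule: rev_cases; simp)
  then show "rise (rev w) x = fall w x" "fall (rev w) x = rise w x"
    using s before_append[of x s v] after_append[of x s v]
      before_append[of x "rev v" "rev s"] after_append[of x "rev v" "rev s"]
    by (simp_all add: rise_def fall_def w)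
qed

lemma hop_exists_backwards:
  assumes "distinct w'" "x \<in> set w'" "\<not> rise w' x" "fall w' x" "0 < x"
  shows "\<exists>w. hop x w w'"
proof -
  obtain w where "hop x (rev w') w"
    using hop_exists[of "rev w'" x] assms rise_fall_rev[of w' x] by auto
  from hop_rev[OF this] show ?thesis by auto
qed

definition valleys :: "nat list \<Rightarrow> nat set" where
  "valleys w = {c \<in> set w. \<not> rise w c \<and> \<not> fall w c}"

definition double_ascents :: "nat list \<Rightarrow> nat set" where
  "double_ascents w = {c \<in> set w. rise w c \<and> \<not> fall w c}"

lemma hop_shape:
  assumes "hop x w w'" "0 \<notin> set w"
  shows "valleys w' = valleys w" "double_descents w' = insert x (double_descents w)"
    "x \<notin> double_descents w" "double_ascents w' = double_ascents w - {x}"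
proof -
  note hs = hop_set_distinct[OF assms(1)] and hl = hop_letterwise[OF assms(1)]
    and ha = hop_at[OF assms(1)]
  have t: "rise w' c = rise w c" "fall w' c = fall w c" if "c \<in> set w" "c \<noteq> x" for c
    using hl that by auto
  have "0 \<notin> set w'" using hs assms by simp
  note dd = double_descents_eq[OF hs(2) assms(2)] double_descents_eq[OF hs(3) this]
  show "valleys w' = valleys w" "x \<notin> double_descents w"
    "double_descents w' = insert x (double_descents w)"
    "double_ascents w' = double_ascents w - {x}"
    unfolding valleys_def double_ascents_def dd using hs ha t by auto
qed

lemma hop_statistics:
  assumes "hop x w w'" "odd x"
  shows "lema w' = lema w" "pat_2_13 w' = pat_2_13 w" "pat_31_2 w' = pat_31_2 w"
proof -
  note hs = hop_set_distinct[OF assms(1)] and hl = hop_letterwise[OF assms(1)]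
  have "even c \<Longrightarrow> c \<noteq> x" for c using assms(2) by auto
  then show "lema w' = lema w"
    unfolding lema_eq[OF hs(2)] lema_eq[OF hs(3)] hs(1)
    by (intro arg_cong[of _ _ card] Collect_cong) (use hl(5) in blast)
  show "pat_2_13 w' = pat_2_13 w" "pat_31_2 w' = pat_31_2 w"
    unfolding pat_2_13_eq[OF hs(2)] pat_2_13_eq[OF hs(3)]
      pat_31_2_eq[OF hs(2)] pat_31_2_eq[OF hs(3)] hs(1)
    using hl by (auto intro!: sum.cong)
qed

section \<open>Descents, valleys and peaks\<close>

lemma descents_eq_image:
  "descents w = (\<lambda>i. (letter w i, letter w (i + 1))) `
    {i. 1 \<le> i \<and> i < length w \<and> letter w i > letter w (i + 1)}"
  by (auto simp: descents_def)

lemma des_eq_card_positions: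
  assumes "distinct w"
  shows "des w = card {i. 1 \<le> i \<and> i < length w \<and> letter w i > letter w (i + 1)}"
proof -
  have "inj_on (\<lambda>i. (letter w i, letter w (i + 1)))
      {i. 1 \<le> i \<and> i < length w \<and> letter w i > letter w (i + 1)}"
    using inj_on_letter[OF assms] by (auto simp: inj_on_def)
  then show ?thesis
    unfolding des_def descents_eq_image by (rule card_image)
qed

lemma des_eq_card_bottoms:
  assumes "distinct w" "0 \<notin> set w"
  shows "des w = card {c \<in> set w. \<not> rise w c}"
proof -
  let ?I = "{i. 1 \<le> i \<and> i < length w \<and> letter w i > letter w (i + 1)}"
  have "{c \<in> set w. \<not> rise w c} = (\<lambda>i. letter w (i + 1)) ` ?I"
  proof (intro set_eqI iffI)
    fix c assume "c \<in> {c \<in> set w. \<not> rise w c}"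
    then obtain i where i: "1 \<le> i" "i \<le> length w" "c = letter w i" "\<not> rise w c"
      by (auto simp: set_eq_letters)
    have "letter w (i - 1) > letter w i"
      using i letter_neq_neighbour(1)[OF assms i(1,2)] rise_letter[OF assms(1) i(1,2)] by auto
    moreover from this have "i - 1 \<ge> 1" by (simp add: letter_def split: if_splits)
    ultimately show "c \<in> (\<lambda>i. letter w (i + 1)) ` ?I"
      using i by (intro image_eqI[of _ _ "i - 1"]) auto
  next
    fix c assume "c \<in> (\<lambda>i. letter w (i + 1)) ` ?I"
    then obtain i where i: "i \<in> ?I" "c = letter w (i + 1)" by blast
    then show "c \<in> {c \<in> set w. \<not> rise w c}"
      using rise_letter[OF assms(1), of "i + 1"] letter_in_set[of "i + 1" w] by auto
  qed
  moreover have "inj_on (\<lambda>i. letter w (i + 1)) ?I"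
  proof (rule inj_onI)
    fix i j assume "i \<in> ?I" "j \<in> ?I" "letter w (i + 1) = letter w (j + 1)"
    then show "i = j" using inj_onD[OF inj_on_letter[OF assms(1)], of "i + 1" "j + 1"] by auto
  qed
  ultimately show ?thesis
    by (simp add: des_eq_card_positions[OF assms(1)] card_image)
qed

text \<open>
  The additional letter is the last one: it falls to the border 0, and this is not a descent of the
  word.
\<close>

lemma Suc_des_eq_card_tops:
  assumes "distinct w" "0 \<notin> set w" "w \<noteq> []"
  shows "Suc (des w) = card {c \<in> set w. fall w c}"
proof -
  let ?I = "{i. 1 \<le> i \<and> i < length w \<and> letter w i > letter w (i + 1)}"
  have len: "1 \<le> length w" using assms(3) by (cases w) auto
  have "letter w (length w) \<noteq> 0"
    using letter_in_set[OF len order_refl] assms(2) by metis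
  then have last: "letter w (length w + 1) < letter w (length w)"
    by (simp add: letter_def)
  have "{c \<in> set w. fall w c} = letter w ` insert (length w) ?I"
  proof (intro set_eqI iffI)
    fix c assume "c \<in> {c \<in> set w. fall w c}"
    then obtain i where "1 \<le> i" "i \<le> length w" "c = letter w i" "fall w c"
      by (auto simp: set_eq_letters)
    then show "c \<in> letter w ` insert (length w) ?I"
      using fall_letter[OF assms(1), of i] by (auto simp: le_less)
  next
    fix c assume "c \<in> letter w ` insert (length w) ?I"
    then obtain i where i: "i \<in> insert (length w) ?I" "c = letter w i" by blast
    then have "1 \<le> i" "i \<le> length w" "letter w (i + 1) < letter w i" using len last by auto
    then show "c \<in> {c \<in> set w. fall w c}"
      using i fall_letter[OF assms(1), of i] letter_in_set[of i w] by auto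
  qed
  moreover have "inj_on (letter w) (insert (length w) ?I)"
    using len by (intro inj_on_subset[OF inj_on_letter[OF assms(1)]]) auto
  moreover have "finite ?I" by (rule finite_subset[of _ "{..length w}"]) auto
  ultimately show ?thesis
    by (simp add: des_eq_card_positions[OF assms(1)] card_image)
qed

lemma des_eq_valleys_plus_dd:
  assumes "distinct w" "0 \<notin> set w"
  shows "des w = card (valleys w) + dd w"
proof -
  have "{c \<in> set w. \<not> rise w c} = valleys w \<union> double_descents w"
    unfolding valleys_def double_descents_eq[OF assms] by auto
  moreover have "valleys w \<inter> double_descents w = {}" "finite (valleys w)" "finite (double_descents w)"
    unfolding valleys_def double_descents_eq[OF assms] by auto
  ultimately show ?thesis
    by (simp add: des_eq_card_bottoms[OF assms] dd_def card_Un_disjoint)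
qed

section \<open>The words whose even letters are double ascents\<close>

text \<open>
  An even letter that is neither the top nor the bottom of a descent rises from its left neighbour
  and is smaller than its right neighbour, if it has one; that the last letter is odd ensures that
  it has one.
\<close>

lemma Ystar_iff:
  "w \<in> Ystar n \<longleftrightarrow> set w = {1..2 * n + 1} \<and> distinct w \<and>
    (\<forall>c\<in>set w. even c \<longrightarrow> rise w c \<and> \<not> fall w c)"
proof (cases "set w = {1..2 * n + 1} \<and> distinct w")
  case False
  then show ?thesis by (auto simp: Ystar_def permutations_of_set_def)
next
  case True
  then have d: "distinct w" and z: "0 \<notin> set w" and len: "length w = 2 * n + 1"
    using distinct_card[of w] by auto
  have "(\<forall>(a, b)\<in>descents w. odd a \<and> odd b) \<and> odd (letter w (2 * n + 1)) \<longleftrightarrow>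
    (\<forall>c\<in>set w. even c \<longrightarrow> rise w c \<and> \<not> fall w c)" (is "?L \<longleftrightarrow> ?R")
  proof
    assume L: ?L
    have desc: "odd (letter w i) \<and> odd (letter w (i + 1))"
      if "1 \<le> i" "i < length w" "letter w i > letter w (i + 1)" for i
      using L that unfolding descents_def by blast
    show ?R
    proof (intro ballI impI)
      fix c assume "c \<in> set w" "even c"
      then obtain i where i: "1 \<le> i" "i \<le> length w" "c = letter w i" "even (letter w i)"
        by (auto simp: set_eq_letters)
      have "rise w c"
      proof (rule ccontr)
        assume "\<not> rise w c"
        then have "letter w (i - 1) > letter w i"
          using i letter_neq_neighbour(1)[OF d z i(1,2)] rise_letter[OF d i(1,2)] by auto
        moreover from this have "i - 1 \<ge> 1" by (simp add: letter_def split: if_splits)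
        moreover have "i - 1 < length w" "i - 1 + 1 = i" using i by auto
        ultimately show False using desc[of "i - 1"] i(4) by (simp only:)
      qed
      moreover have "\<not> fall w c"
      proof
        assume "fall w c"
        then have "letter w i > letter w (i + 1)" using i fall_letter[OF d i(1,2)] by auto
        moreover have "i < length w" using i L len by (cases "i = length w") auto
        ultimately show False using desc[of i] i by auto
      qed
      ultimately show "rise w c \<and> \<not> fall w c" ..
    qed
  next
    assume R: ?R
    have "odd (letter w i) \<and> odd (letter w (i + 1))"
      if "1 \<le> i" "i < length w" "letter w i > letter w (i + 1)" for i
      using that R fall_letter[OF d, of i] rise_letter[OF d, of "i + 1"]
        letter_in_set[of i w] letter_in_set[of "i + 1" w] by auto
    moreover have "odd (letter w (2 * n + 1))"
    proof -
      have l: "letter w (2 * n + 1) \<in> set w" using len by (intro letter_in_set) auto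
      then have "letter w (2 * n + 1) \<noteq> 0" using z by metis
      then have "fall w (letter w (2 * n + 1))"
        using fall_letter[OF d, of "2 * n + 1"] len by (simp add: letter_def)
      then show ?thesis using R l by blast
    qed
    ultimately show ?L unfolding descents_def by auto
  qed
  then show ?thesis
    using True by (auto simp: Ystar_def permutations_of_set_def)
qed

lemma Ystar_word:
  assumes "w \<in> Ystar n"
  shows "distinct w" "0 \<notin> set w" "set w = {1..2 * n + 1}" "w \<noteq> []"
  using assms unfolding Ystar_iff by auto

lemma hop_Ystar:
  assumes "hop x w w'" "odd x"
  shows "w' \<in> Ystar n \<longleftrightarrow> w \<in> Ystar n"
proof -
  have "even c \<Longrightarrow> c \<noteq> x" for c using assms(2) by auto
  then show ?thesis
    unfolding Ystar_iff
    using hop_set_distinct[OF assms(1)] hop_letterwise(3,4)[OF assms(1)] by metis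
qed

text \<open>
  The last letter always falls to the border 0, so it is a peak exactly when it is not a double
  descent.
\<close>

lemma F_permutations_eq: "F_permutations n = {w \<in> Ystar n. double_descents w = {}}"
proof -
  have "letter w (2 * n + 1) \<in> peaks w" if w: "w \<in> Ystar n" "double_descents w = {}" for w
  proof -
    note yw = Ystar_word[OF w(1)]
    have len: "length w = 2 * n + 1" using distinct_card[OF yw(1)] yw(3) by simp
    have l: "letter w (2 * n + 1) \<in> set w" using len by (intro letter_in_set) auto
    then have "letter w (2 * n + 1) \<noteq> 0" using yw(2) by metis
    then have "fall w (letter w (2 * n + 1))"
      using fall_letter[OF yw(1), of "2 * n + 1"] len by (simp add: letter_def)
    then show ?thesis
      using l w(2) unfolding double_descents_eq[OF yw(1,2)] peaks_eq[OF yw(1)] by blast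
  qed
  then show ?thesis unfolding F_permutations_def by blast
qed

lemma card_odd_letters: "card {c \<in> {1..2 * n + 1::nat}. odd c} = n + 1"
proof -
  have "{c \<in> {1..2 * n + 1::nat}. odd c} = (\<lambda>i. 2 * i + 1) ` {..n}"
    by (auto elim!: oddE)
  then show ?thesis by (simp add: card_image inj_on_def)
qed

text \<open>
  Descents are counted once by their bottoms, here the valleys, and once by their tops, which
  together with the last letter are the peaks.
\<close>

lemma card_odd_double_ascents:
  assumes "w \<in> Ystar n" "double_descents w = {}"
  shows "card ({c \<in> {1..2 * n + 1}. odd c} \<inter> double_ascents w) + 2 * des w = n"
proof -
  note yw = Ystar_word[OF assms(1)]
  let ?O = "{c \<in> {1..2 * n + 1}. odd c}" and ?P = "{c \<in> set w. fall w c}"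
  have "\<forall>c\<in>set w. even c \<longrightarrow> rise w c \<and> \<not> fall w c"
    using assms(1) by (simp add: Ystar_iff)
  moreover have "\<not> (\<not> rise w c \<and> fall w c)" if "c \<in> set w" for c
    using that assms(2) unfolding double_descents_eq[OF yw(1,2)] by blast
  ultimately have "?O = (?O \<inter> double_ascents w) \<union> (valleys w \<union> ?P)"
    unfolding double_ascents_def valleys_def using yw(3) by blast
  moreover have "(?O \<inter> double_ascents w) \<inter> (valleys w \<union> ?P) = {}" "valleys w \<inter> ?P = {}"
    "finite (?O \<inter> double_ascents w)" "finite (valleys w)" "finite ?P"
    unfolding double_ascents_def valleys_def by auto
  ultimately have "card ?O = card (?O \<inter> double_ascents w) + (card (valleys w) + card ?P)"
    by (metis (no_types, lifting) card_Un_disjoint finite_UnI)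
  moreover have "card (valleys w) = des w"
    using des_eq_valleys_plus_dd[OF yw(1,2)] assms(2) by (simp add: dd_def)
  ultimately show ?thesis
    using Suc_des_eq_card_tops[OF yw(1,2,4)] card_odd_letters[of n] by simp
qed

section \<open>Removing double descents one letter at a time\<close>

text \<open>
  The hop of \<open>x\<close> is a bijection between the two index sets.  The condition that no letter of \<open>X\<close> is
  a double descent is carried along, because only the type of \<open>x \<notin> X\<close> changes.
\<close>

lemma sum_double_descents_eq_sum_double_ascents:
  fixes g h :: "nat list \<Rightarrow> 'a::comm_monoid_add"
  assumes x: "odd x" "x \<in> {1..2 * n + 1}" "x \<notin> X"
    and eq: "\<And>w w'. hop x w w' \<Longrightarrow> w \<in> Ystar n \<Longrightarrow> g w' = h w"
  shows "(\<Sum>w | w \<in> Ystar n \<and> double_descents w \<inter> X = {} \<and> x \<in> double_descents w. g w) =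
    (\<Sum>w | w \<in> Ystar n \<and> double_descents w \<inter> X = {} \<and> x \<in> double_ascents w. h w)"
    (is "sum g ?D = sum h ?A")
proof -
  let ?f = "\<lambda>w. THE w'. hop x w w'" and ?b = "\<lambda>w'. THE w. hop x w w'"
  have f: "hop x w (?f w)" "?f w \<in> ?D" "?b (?f w) = w" if "w \<in> ?A" for w
  proof -
    have w: "w \<in> Ystar n" "x \<in> double_ascents w" "double_descents w \<inter> X = {}" using that by auto
    note yw = Ystar_word[OF w(1)]
    obtain w' where w': "hop x w w'"
      using hop_exists[OF yw(1), of x] w(2) x(2) by (auto simp: double_ascents_def)
    then have "?f w = w'" using hop_functional by blast
    moreover have "?b w' = w" using w' hop_injective by blast
    moreover have "w' \<in> ?D"
      using w x(3) hop_Ystar[OF w' x(1)] hop_shape[OF w' yw(2)] by auto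
    ultimately show "hop x w (?f w)" "?f w \<in> ?D" "?b (?f w) = w" using w' by auto
  qed
  have b: "?b w' \<in> ?A \<and> ?f (?b w') = w'" if "w' \<in> ?D" for w'
  proof -
    have w': "w' \<in> Ystar n" "x \<in> double_descents w'" "double_descents w' \<inter> X = {}" using that by auto
    note yw = Ystar_word[OF w'(1)]
    obtain w where w: "hop x w w'"
      using hop_exists_backwards[OF yw(1), of x] w'(2) x(2)
      unfolding double_descents_eq[OF yw(1,2)] by auto
    have Y: "w \<in> Ystar n" using w'(1) hop_Ystar[OF w x(1)] by blast
    moreover have "0 \<notin> set w" using Ystar_word(2)[OF Y] .
    moreover have "x \<in> double_ascents w"
      using hop_at[OF w] hop_set_distinct[OF w] by (simp add: double_ascents_def)
    ultimately have "w \<in> ?A" using w'(3) hop_shape(2)[OF w] by simp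
    moreover have "?b w' = w" using w hop_injective by blast
    moreover have "?f w = w'" using w hop_functional by blast
    ultimately show ?thesis by simp
  qed
  show ?thesis
  proof (rule sum.reindex_bij_witness[of _ ?f ?b])
    fix w' assume w': "w' \<in> ?D"
    from b[OF w'] show "?b w' \<in> ?A" "?f (?b w') = w'" by (rule conjunct1, rule conjunct2)
    then show "h (?b w') = g w'" using f(1)[of "?b w'"] eq[of "?b w'" w'] by simp
  next
    fix w assume w: "w \<in> ?A"
    show "?b (?f w) = w" "?f w \<in> ?D" by (rule f(3)[OF w], rule f(2)[OF w])
  qed
qed

text \<open>
  Adding \<open>x\<close> to \<open>X\<close>: a word in which \<open>x\<close> is a double descent has \<open>z\<close> times the weight of the word
  from which it arises by the hop of \<open>x\<close>.  Both together contribute \<open>1 + z\<close> times the weight of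
  the latter.
\<close>

lemma sum_Ystar_without_double_descents_in:
  fixes a p q t z :: "'a::comm_ring_1"
  assumes "finite X" "X \<subseteq> {c \<in> {1..2 * n + 1}. odd c}"
  shows "(\<Sum>w\<in>Ystar n. a ^ lema w * p ^ pat_2_13 w * q ^ pat_31_2 w * t ^ card (valleys w) * z ^ dd w) =
    (\<Sum>w | w \<in> Ystar n \<and> double_descents w \<inter> X = {}.
      a ^ lema w * p ^ pat_2_13 w * q ^ pat_31_2 w * t ^ card (valleys w) * z ^ dd w *
      (1 + z) ^ card (X \<inter> double_ascents w))"
  using assms
proof (induction X)
  case empty
  then show ?case by simp
next
  case (insert x X)
  define g where "g = (\<lambda>w. a ^ lema w * p ^ pat_2_13 w * q ^ pat_31_2 w *
    t ^ card (valleys w) * z ^ dd w * (1 + z) ^ card (X \<inter> double_ascents w))"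
  let ?Y = "{w. w \<in> Ystar n \<and> double_descents w \<inter> X = {}}"
  let ?D = "{w. w \<in> Ystar n \<and> double_descents w \<inter> X = {} \<and> x \<in> double_descents w}"
  let ?A = "{w. w \<in> Ystar n \<and> double_descents w \<inter> X = {} \<and> x \<in> double_ascents w}"
  let ?N = "{w. w \<in> Ystar n \<and> double_descents w \<inter> insert x X = {}}"
  have x: "odd x" "x \<in> {1..2 * n + 1}" "x \<notin> X" using insert by auto
  have fin: "finite ?D" "finite ?N" "finite ?A"
    by (auto intro: finite_subset[OF _ finite_Ystar[of n]])
  have hop: "g w' = z * g w" if h: "hop x w w'" and w: "w \<in> Ystar n" for w w'
  proof -
    note sh = hop_shape[OF h Ystar_word(2)[OF w]]
    have "dd w' = Suc (dd w)"
      using sh(2,3) double_descents_eq[OF Ystar_word(1,2)[OF w]] by (simp add: dd_def)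
    moreover have "X \<inter> double_ascents w' = X \<inter> double_ascents w" using sh(4) x(3) by auto
    ultimately show ?thesis
      using sh(1) hop_statistics[OF h x(1)] by (simp add: g_def mult_ac)
  qed
  have sub: "?A \<subseteq> ?N"
  proof
    fix w assume w: "w \<in> ?A"
    then have "x \<notin> double_descents w"
      using double_descents_eq[OF Ystar_word(1,2)[of w n]] by (auto simp: double_ascents_def)
    then show "w \<in> ?N" using w by auto
  qed
  have "(\<Sum>w\<in>?Y. g w) = (\<Sum>w\<in>?N. g w) + (\<Sum>w\<in>?D. g w)"
    using fin by (subst sum.union_disjoint[symmetric]) (auto intro!: sum.cong)
  also have "(\<Sum>w\<in>?D. g w) = (\<Sum>w\<in>?A. z * g w)"
    using x hop by (rule sum_double_descents_eq_sum_double_ascents)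
  also have "\<dots> = (\<Sum>w\<in>?N. if x \<in> double_ascents w then z * g w else 0)"
    using sub fin by (intro sum.mono_neutral_cong_left) auto
  also have "(\<Sum>w\<in>?N. g w) + \<dots> =
      (\<Sum>w\<in>?N. g w * (if x \<in> double_ascents w then 1 + z else 1))"
    by (subst sum.distrib[symmetric]) (auto intro!: sum.cong simp: algebra_simps)
  also have "\<dots> = (\<Sum>w\<in>?N. a ^ lema w * p ^ pat_2_13 w * q ^ pat_31_2 w *
      t ^ card (valleys w) * z ^ dd w * (1 + z) ^ card (insert x X \<inter> double_ascents w))"
    using x(3) insert.hyps(1) by (intro sum.cong) (auto simp: g_def mult_ac)
  finally show ?case
    using insert by (simp add: g_def)
qed

theorem theorem18:
  fixes n :: nat and a p q y t :: "'a::comm_ring_1"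
  assumes "n \<ge> 1"
  shows "(\<Sum>w\<in>Ystar n. a ^ lema w * p ^ pat_2_13 w * q ^ pat_31_2 w * y ^ dd w * t ^ des w)
    = (\<Sum>k=0..n div 2. gamma_coeff n k a p q * t ^ k * (1 + y * t) ^ (n - 2 * k))"
proof -
  let ?O = "{c \<in> {1..2 * n + 1}. odd c}"
  let ?s = "\<lambda>w. a ^ lema w * p ^ pat_2_13 w * q ^ pat_31_2 w"
  \<comment> \<open>Each double descent is the bottom of a descent, which pays for its factor \<open>t\<close>.\<close>
  have "(\<Sum>w\<in>Ystar n. ?s w * y ^ dd w * t ^ des w) =
      (\<Sum>w\<in>Ystar n. ?s w * t ^ card (valleys w) * (y * t) ^ dd w)"
  proof (rule sum.cong)
    fix w assume "w \<in> Ystar n"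
    then have "des w = card (valleys w) + dd w"
      by (intro des_eq_valleys_plus_dd) (rule Ystar_word; assumption)+
    then show "?s w * y ^ dd w * t ^ des w = ?s w * t ^ card (valleys w) * (y * t) ^ dd w"
      by (simp add: power_add power_mult_distrib mult_ac)
  qed simp
  also have "\<dots> = (\<Sum>w | w \<in> Ystar n \<and> double_descents w \<inter> ?O = {}.
      ?s w * t ^ card (valleys w) * (y * t) ^ dd w * (1 + y * t) ^ card (?O \<inter> double_ascents w))"
    by (rule sum_Ystar_without_double_descents_in) auto
  also have "\<dots> = (\<Sum>w\<in>F_permutations n. ?s w * t ^ des w * (1 + y * t) ^ (n - 2 * des w))"
  proof (rule sum.cong)
    have "double_descents w \<subseteq> ?O" if "w \<in> Ystar n" for w
      using that unfolding double_descents_eq[OF Ystar_word(1,2)[OF that]] by (auto simp: Ystar_iff)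
    then show "{w. w \<in> Ystar n \<and> double_descents w \<inter> ?O = {}} = F_permutations n"
      unfolding F_permutations_eq by blast
  next
    fix w assume "w \<in> F_permutations n"
    then have w: "w \<in> Ystar n" "double_descents w = {}" by (auto simp: F_permutations_eq)
    then have "dd w = 0" "des w = card (valleys w)"
      using des_eq_valleys_plus_dd[OF Ystar_word(1,2)[OF w(1)]] by (auto simp: dd_def)
    moreover have "card (?O \<inter> double_ascents w) = n - 2 * des w"
      using card_odd_double_ascents[OF w] by linarith
    ultimately show "?s w * t ^ card (valleys w) * (y * t) ^ dd w *
        (1 + y * t) ^ card (?O \<inter> double_ascents w) =
        ?s w * t ^ des w * (1 + y * t) ^ (n - 2 * des w)"
      by simp
  qed
  also have "\<dots> = (\<Sum>k\<in>{0..n div 2}. \<Sum>w\<in>{w \<in> F_permutations n. des w = k}.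
      ?s w * t ^ des w * (1 + y * t) ^ (n - 2 * des w))"
  proof (rule sum.group[symmetric])
    show "des ` F_permutations n \<subseteq> {0..n div 2}"
    proof (rule image_subsetI)
      fix w assume "w \<in> F_permutations n"
      then have "2 * des w \<le> n"
        using card_odd_double_ascents[of w n] by (simp add: F_permutations_eq)
      then show "des w \<in> {0..n div 2}" by simp
    qed
  qed (auto simp: F_permutations_def finite_Ystar)
  also have "\<dots> = (\<Sum>k=0..n div 2. gamma_coeff n k a p q * t ^ k * (1 + y * t) ^ (n - 2 * k))"
    unfolding gamma_coeff_def F_permutations_des_def
    by (intro sum.cong) (auto simp: sum_distrib_right)
  finally show ?thesis .
qed

end
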